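(* For every odd prime $p$, each of the rings $\mathrm{Mat}_{p-1}(\mathbb{Z})$ and $\mathrm{Mat}_p(\mathbb{Z})$ contains an exceptional clique consisting of $p+1$ symmetric matrices with coefficients in $\{-2,-1,0,1\}$.
   Context: $\mathrm{Mat}_n(\mathbb{Z})$ is the ring of $n\times n$ integer matrices. An exceptional clique in a unital ring $R$ is a subset $C\subseteq R$ such that $u-v$ is a unit of $R$ for all distinct $u,v\in C$. *)

theory Defs
  imports
    "HOL-Algebra.Ring"
    "HOL-Computational_Algebra.Primes"
    "Jordan_Normal_Form.Matrix"
begin

definition exceptional_clique :: "('a, 'b) ring_scheme \<Rightarrow> 'a set \<Rightarrow> bool" where
  "exceptional_clique R C \<longleftrightarrow>
     C \<subseteq> carrier R \<and> (\<forall>u\<in>C. \<forall>v\<in>C. u \<noteq> v \<longrightarrow> u \<ominus>\<^bsub>R\<^esub> v \<in> Units R)"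

abbreviation int_mat_ring :: "nat \<Rightarrow> int mat ring" where
  "int_mat_ring n \<equiv> ring_mat TYPE(int) n ()"

end

(*
Index rows and columns by Z/p. Let X = S + S^-1 - 1, where S is the cyclic shift, and let P_a be the
permutation matrix of the reflection k -> 2a - k. For n = p - 1 the clique is X together with the P_a,
all with row and column 0 deleted; for n = p it is X together with P_a - E_(a,a) + E_(a+2,a+2).
A difference A of two of them is invertible over Z as soon as, for every integer m (including 0),
A x = 0 mod m implies x = 0 mod m. The equations A x = 0 are linear recursions for a p-periodic
sequence x, and since p is odd (prime, for the differences of reflections) the recursion runs through
all residues and forces x to vanish. For n = p - 1 the full differences have zero column sums, so the
equation of the deleted row comes for free.
*)
theory Submission
  imports Defs "HOL-Number_Theory.Cong" "Jordan_Normal_Form.Determinant"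
begin

section \<open>Invertibility over the integers from kernels modulo every m\<close>

text \<open>Taking \<open>m = 0\<close> shows that the determinant is nonzero; taking \<open>m = det A\<close> on the columns of the
  adjugate shows that the adjugate divided by the determinant is integral.\<close>
lemma Units_int_mat_ringI:
  assumes A: "A \<in> carrier_mat n n"
    and ker: "\<And>m v. v \<in> carrier_vec n \<Longrightarrow> \<forall>i<n. m dvd (A *\<^sub>v v) $ i \<Longrightarrow> \<forall>i<n. m dvd v $ i"
  shows "A \<in> Units (int_mat_ring n)"
proof -
  have det: "det A \<noteq> 0"
  proof
    assume "det A = 0"
    then obtain v where v: "v \<in> carrier_vec n" "v \<noteq> 0\<^sub>v n" "A *\<^sub>v v = 0\<^sub>v n"
      using det_0_iff_vec_prod_zero[OF A] by blast
    with ker[of v 0] have "v = 0\<^sub>v n" by auto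
    with v show False by simp
  qed
  define B where "B = map_mat (\<lambda>x. x div det A) (adj_mat A)"
  have adj: "adj_mat A \<in> carrier_mat n n" "A * adj_mat A = det A \<cdot>\<^sub>m 1\<^sub>m n"
    "adj_mat A * A = det A \<cdot>\<^sub>m 1\<^sub>m n"
    using adj_mat[OF A] by auto
  have B: "B \<in> carrier_mat n n" using adj(1) by (simp add: B_def)
  have "det A dvd adj_mat A $$ (i, j)" if ij: "i < n" "j < n" for i j
  proof -
    have "A *\<^sub>v col (adj_mat A) j = col (A * adj_mat A) j"
      using A adj(1) ij by (auto simp: col_mult2)
    also have "\<dots> = col (det A \<cdot>\<^sub>m 1\<^sub>m n) j" by (simp only: adj(2))
    finally have "\<forall>i<n. det A dvd (A *\<^sub>v col (adj_mat A) j) $ i"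
      using ij by auto
    from ker[OF _ this] show ?thesis using adj(1) ij by auto
  qed
  hence adjB: "adj_mat A = det A \<cdot>\<^sub>m B"
    using adj(1) by (intro eq_matI) (auto simp: B_def)
  have cancel: "C = D" if "det A \<cdot>\<^sub>m C = det A \<cdot>\<^sub>m D" "C \<in> carrier_mat n n" "D \<in> carrier_mat n n"
    for C D
  proof (rule eq_matI)
    fix i j assume "i < dim_row D" "j < dim_col D"
    with that(2,3) arg_cong[OF that(1), of "\<lambda>M. M $$ (i, j)"] det
    show "C $$ (i, j) = D $$ (i, j)" by auto
  qed (use that in auto)
  have "det A \<cdot>\<^sub>m (A * B) = det A \<cdot>\<^sub>m 1\<^sub>m n"
    using mult_smult_distrib[OF A B, of "det A"] adj(2) unfolding adjB by (simp only:)
  hence "A * B = 1\<^sub>m n" by (rule cancel) (use A B in auto)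
  moreover have "det A \<cdot>\<^sub>m (B * A) = det A \<cdot>\<^sub>m 1\<^sub>m n"
    using mult_smult_assoc_mat[OF B A, of "det A"] adj(3) unfolding adjB by (simp only:)
  hence "B * A = 1\<^sub>m n" by (rule cancel) (use A B in auto)
  ultimately show ?thesis
    using A B unfolding Units_def ring_mat_def by (auto intro!: bexI[of _ B])
qed

section \<open>Periodic sequences and their recursions modulo m\<close>

definition periodic :: "int \<Rightarrow> (int \<Rightarrow> int) \<Rightarrow> bool" where
  "periodic p x \<longleftrightarrow> (\<forall>k l. [k = l] (mod p) \<longrightarrow> x k = x l)"

lemma periodicD: "periodic p x \<Longrightarrow> [k = l] (mod p) \<Longrightarrow> x k = x l"
  by (auto simp: periodic_def)

text \<open>\<open>d\<close> generates Z/p, so every residue is reached from \<open>k\<close> by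
  steps of length \<open>d\<close>. The number of steps is a natural number so that inductions can
  run along the steps.\<close>

lemma cong_nat_multiple:
  fixes d p k l :: int
  assumes "coprime d p" "p > 0"
  obtains s :: nat where "[k + int s * d = l] (mod p)"
proof -
  obtain t where t: "[d * t = 1] (mod p)"
    using assms(1) cong_solve_coprime_int by blast
  define s where "s = nat ((t * (l - k)) mod p)"
  have s: "[int s = t * (l - k)] (mod p)"
    using assms(2) by (simp add: s_def cong_def)
  have "[k + int s * d = k + t * (l - k) * d] (mod p)"
    using s by (intro cong_add cong_mult) auto
  also have "k + t * (l - k) * d = k + (d * t) * (l - k)" by (simp add: algebra_simps)
  also have "[\<dots> = k + 1 * (l - k)] (mod p)"
    using t by (intro cong_add cong_mult) auto
  finally show ?thesis using that by simp
qed

lemma dvd_diff_if_dvd_steps: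
  fixes m :: int
  assumes "a \<le> b" "\<And>i. a \<le> i \<Longrightarrow> i < b \<Longrightarrow> m dvd f (Suc i) - f i"
  shows "m dvd f b - f a"
  using assms
proof (induction b rule: dec_induct)
  case (step n)
  have "m dvd (f (Suc n) - f n) + (f n - f a)"
    using step by (intro dvd_add) auto
  thus ?case by simp
qed simp

lemma periodic_const_mod:
  assumes x: "periodic p x" and d: "coprime d p" "p > 0"
    and step: "\<And>k. m dvd x (k + d) - x k"
  shows "m dvd x k - x l"
proof -
  obtain s where s: "[l + int s * d = k] (mod p)"
    using cong_nat_multiple[OF d] .
  have "m dvd x (l + int s * d) - x (l + int 0 * d)"
    by (rule dvd_diff_if_dvd_steps) (use step[of "l + int _ * d"] in \<open>auto simp: algebra_simps\<close>)
  thus ?thesis using periodicD[OF x s] by simp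
qed

text \<open>Subtracting the relation at 2a - k from the one at k leaves a two-step recursion for the
  antisymmetric part \<open>d\<close>. It vanishes at a, hence everywhere, as 2 generates Z/p. The
  relation then says that second differences of x vanish, so the first differences \<open>e\<close>
  are constant modulo m.\<close>

lemma reflected_recursion_const_mod:
  assumes x: "periodic p x" and p: "odd p" "p > 0"
    and rel: "\<And>k. m dvd x (k + 1) + x (k - 1) - x k - x (2 * a - k)"
  shows "m dvd x k - x l"
proof -
  have cop: "coprime 2 p" using p by simp
  define d where "d k = x k - x (2 * a - k)" for k
  have d_step: "m dvd d (k + 1) + d (k - 1)" for k
  proof -
    have "m dvd (x (k + 1) + x (k - 1) - x k - x (2 * a - k)) -
       (x (2 * a - k + 1) + x (2 * a - k - 1) - x (2 * a - k) - x (2 * a - (2 * a - k)))"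
      by (intro dvd_diff rel)
    thus ?thesis by (simp add: d_def algebra_simps)
  qed
  have d_even: "m dvd d (a + int s * 2)" for s
  proof (induction s)
    case (Suc s)
    have "m dvd (d (a + int s * 2 + 1 + 1) + d (a + int s * 2 + 1 - 1)) - d (a + int s * 2)"
      by (intro dvd_diff d_step Suc.IH)
    thus ?case by (simp add: algebra_simps)
  qed (simp add: d_def)
  have d: "m dvd d k" for k
  proof -
    obtain s where s: "[a + int s * 2 = k] (mod p)"
      using cong_nat_multiple[OF cop p(2)] .
    have "[2 * a - (a + int s * 2) = 2 * a - k] (mod p)"
      by (intro cong_diff s) auto
    with s have "d (a + int s * 2) = d k"
      unfolding d_def by (simp add: periodicD[OF x])
    with d_even[of s] show ?thesis by simp
  qed
  define e where "e k = x (k + 1) - x k" for k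
  have "[k + 1 = l + 1] (mod p)" if "[k = l] (mod p)" for k l
    using that by (intro cong_add) auto
  hence e_per: "periodic p e"
    using periodicD[OF x] unfolding e_def periodic_def by metis
  have "m dvd e (k + 1) - e k" for k
  proof -
    have "m dvd (x (k + 1 + 1) + x (k + 1 - 1) - x (k + 1) - x (2 * a - (k + 1))) - d (k + 1)"
      by (intro dvd_diff rel d)
    thus ?thesis by (simp add: e_def d_def algebra_simps)
  qed
  hence e: "m dvd e k - e l" for k l
    using periodic_const_mod[OF e_per, of 1] p by simp
  \<comment> \<open>Summing the constant \<open>e\<close> over a period would only give p e = 0,
    which is too weak when m and p share a factor. The symmetry about a gives 2 e = x (a + 1) - x (a
    - 1) = 0 instead.\<close>
  have "m dvd x (k + 2) - x k" for k
  proof -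
    have "m dvd (e k - e a) + (e (k + 1) - e (a - 1)) + d (a + 1)"
      by (intro dvd_add e d)
    thus ?thesis by (simp add: e_def d_def algebra_simps)
  qed
  thus ?thesis using periodic_const_mod[OF x cop p(2)] by simp
qed

text \<open>Along the even indices \<open>2, \<dots>, p - 1\<close> the recursion starts and ends at 0 and jumps by \<open>W \<tau>\<close> once, which
  kills these values and \<open>W \<tau>\<close>; the jump along the odd indices \<open>1, \<dots>, p\<close> is then 0 as well.\<close>
lemma twisted_recursion_zero_mod:
  assumes W: "periodic p W" and p: "p = 2 * int h + 1" and \<tau>: "\<tau> = 2 * int u + 1" "u < h"
    and rel: "\<And>j. 0 \<le> j \<Longrightarrow> j < p \<Longrightarrow> m dvd W (j + 2) - W j
      + (if j = 0 then W 0 else 0) - (if j = p - 1 then W 1 else 0)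
      - (if j = p - \<tau> then W \<tau> else 0) + (if j = p - \<tau> - 1 then W (\<tau> + 1) else 0)"
  shows "m dvd W j"
proof -
  have rel0: "m dvd W (j + 2) - W j"
    if "0 < j" "j < p - 1" "j \<noteq> p - \<tau>" "j \<noteq> p - \<tau> - 1" for j
    using rel[of j] that by auto
  have W2: "m dvd W 2"
    using rel[of 0] \<tau> p by auto
  have even_step: "m dvd W (2 * int (Suc i)) - W (2 * int i)" if "0 < i" "i < h" "i \<noteq> h - u" for i
  proof -
    have "2 * int i \<noteq> p - \<tau>" "2 * int i \<noteq> p - \<tau> - 1"
      using that \<tau> p by presburger+
    hence "m dvd W (2 * int i + 2) - W (2 * int i)"
      using that p by (intro rel0) auto
    thus ?thesis by (simp add: add.commute)
  qed
  have low: "m dvd W (2 * int i)" if "0 < i" "i \<le> h - u" for i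
  proof -
    have "m dvd W (2 * int i) - W (2 * int 1)"
      by (rule dvd_diff_if_dvd_steps) (use that in \<open>auto intro!: even_step simp del: of_nat_Suc\<close>)
    from dvd_add[OF this, of "W 2"] W2 show ?thesis by simp
  qed
  \<comment> \<open>The position p - \<tau> = 2 (h - u) is even, so this jump lies on the even
    chain. For u = 0 it falls on the last index p - 1 and is treated separately below.\<close>
  have jump: "m dvd W (2 * int (Suc (h - u))) - W (2 * int (h - u)) - W \<tau>" if "u \<noteq> 0"
  proof -
    have "2 * int (h - u) = p - \<tau>" "2 * int (Suc (h - u)) = p - \<tau> + 2"
      using \<tau> p by auto
    moreover have "m dvd W (p - \<tau> + 2) - W (p - \<tau>) - W \<tau>"
      using rel[of "p - \<tau>"] \<tau> that unfolding p by simp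
    ultimately show ?thesis by (simp only:)
  qed
  have wrap: "W (p - 1 + 2) = W 1" by (intro periodicD[OF W]) (simp add: cong_def)
  have W\<tau>: "m dvd W \<tau>"
  proof (cases "u = 0")
    case True
    \<comment> \<open>Here \<tau> = 1, and both corrections at p - 1 subtract W 1. One of them
      cancels the wrapped term W (p + 1) = W 1.\<close>
    with rel[of "p - 1"] wrap \<tau> p have "m dvd - (W (p - 1) + W 1)"
      by (simp add: algebra_simps)
    hence "m dvd W (p - 1) + W 1" by (simp only: dvd_minus_iff)
    moreover have "m dvd W (p - 1)" using low[of h] True p \<tau> by simp
    ultimately have "m dvd W 1" using dvd_add_right_iff by blast
    with True \<tau> show ?thesis by simp
  next
    case False
    have "m dvd - W (p - 1)" using rel[of "p - 1"] wrap False \<tau> p by simp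
    hence last: "m dvd W (p - 1)" by (simp only: dvd_minus_iff)
    have "m dvd W (2 * int h) - W (2 * int (Suc (h - u)))"
      by (rule dvd_diff_if_dvd_steps)
        (use False \<tau> in \<open>auto intro!: even_step simp del: of_nat_Suc\<close>)
    from dvd_add[OF this jump[OF False]] p
    have "m dvd W (p - 1) - W (2 * int (h - u)) - W \<tau>"
      by (simp only: p) (simp add: algebra_simps)
    moreover have "m dvd W (p - 1) - W (2 * int (h - u))"
      using last low[of "h - u"] \<tau> by (intro dvd_diff) auto
    ultimately show ?thesis using dvd_diff_right_iff by blast
  qed
  have even_step': "m dvd W (2 * int (Suc i)) - W (2 * int i)" if "0 < i" "i < h" for i
  proof (cases "i = h - u")
    case True
    with that have "u \<noteq> 0" by auto
    from dvd_add[OF jump[OF this] W\<tau>] True show ?thesis by simp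
  qed (use that even_step in auto)
  have ev: "m dvd W (2 * int i)" if "0 < i" "i \<le> h" for i
  proof -
    have "m dvd W (2 * int i) - W (2 * int 1)"
      by (rule dvd_diff_if_dvd_steps) (use that in \<open>auto intro!: even_step' simp del: of_nat_Suc\<close>)
    from dvd_add[OF this, of "W 2"] W2 show ?thesis by simp
  qed
  have odd_step: "m dvd W (2 * int (Suc i) + 1) - W (2 * int i + 1)" if "i < h" for i
  proof -
    \<comment> \<open>The only jump on the odd chain is at p - \<tau> - 1. Its size W (\<tau> + 1)
      has an even index at most 2h and is already known to vanish.\<close>
    have "m dvd W (2 * int (Suc u))" using ev[of "Suc u"] \<tau> by simp
    hence W\<tau>1: "m dvd W (\<tau> + 1)" using \<tau> by (simp add: algebra_simps)
    have ne: "2 * int i + 1 \<noteq> p - \<tau>" "2 * int i + 1 \<noteq> p - 1" "2 * int i + 1 \<noteq> 0"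
      using \<tau> p by presburger+
    have "m dvd W (2 * int i + 1 + 2) - W (2 * int i + 1)
        + (if 2 * int i + 1 = p - \<tau> - 1 then W (\<tau> + 1) else 0)"
      using rel[of "2 * int i + 1"] ne that p by simp
    hence "m dvd W (2 * int i + 1 + 2) - W (2 * int i + 1)"
      using W\<tau>1 dvd_add_left_iff by (auto split: if_splits)
    moreover have "2 * int (Suc i) + 1 = 2 * int i + 1 + 2" by simp
    ultimately show ?thesis by (simp only:)
  qed
  have odd1: "m dvd W (2 * int i + 1) - W 1" if "i \<le> h" for i
  proof -
    have "m dvd W (2 * int i + 1) - W (2 * int 0 + 1)"
      by (rule dvd_diff_if_dvd_steps) (use that in \<open>auto intro!: odd_step simp del: of_nat_Suc\<close>)
    thus ?thesis by simp
  qed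
  \<comment> \<open>\<tau> is itself odd, so the zero at \<tau> spreads along the whole odd
    chain.\<close>
  have "m dvd W \<tau> - W 1" using odd1[of u] \<tau> by simp
  from dvd_diff[OF W\<tau> this] have W1: "m dvd W 1" by simp
  have od: "m dvd W (2 * int i + 1)" if "i \<le> h" for i
    using dvd_add[OF odd1[OF that] W1] by simp
  define r where "r = nat (j mod p)"
  have "p > 0" using p by simp
  hence r: "int r = j mod p" "r < 2 * h + 1"
    using pos_mod_bound[of p j] p by (auto simp: r_def nat_less_iff simp del: pos_mod_bound)
  have "W j = W (int r)" by (intro periodicD[OF W]) (simp add: r cong_def)
  \<comment> \<open>Index 0 is missing from the even chain; it is reached as the odd index p = 2h +
    1.\<close>
  moreover have "W 0 = W p" by (intro periodicD[OF W]) (simp add: cong_def)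
  moreover have "m dvd W (int r)" if "r \<noteq> 0"
  proof (cases "even r")
    case True
    then obtain i where "r = 2 * i" by blast
    with ev[of i] that r show ?thesis by simp
  next
    case False
    then obtain i where "r = 2 * i + 1" using oddE by blast
    with od[of i] r(2) show ?thesis by (simp add: add.commute)
  qed
  ultimately show ?thesis using od[of h] p by (cases "r = 0") auto
qed

section \<open>Indicators of congruence and sums over a period\<close>

text \<open>The identity matrix of Z/p, with arguments in all integers so that shifted and reflected
  indices need no reduction.\<close>

definition cong_ind :: "int \<Rightarrow> int \<Rightarrow> int \<Rightarrow> int" where
  "cong_ind p k l = (if [k = l] (mod p) then 1 else 0)"

lemma cong_ind_commute: "cong_ind p k l = cong_ind p l k"
  by (simp add: cong_ind_def cong_sym_eq)

lemma sum_cong_ind: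
  assumes "p > 0" "periodic p x"
  shows "(\<Sum>l\<in>{0..<p}. cong_ind p k l * x l) = x k"
proof -
  have "[k = l] (mod p) \<longleftrightarrow> l = k mod p" if "l \<in> {0..<p}" for l
    using that by (auto simp: cong_def)
  hence "(\<Sum>l\<in>{0..<p}. cong_ind p k l * x l) = (\<Sum>l\<in>{0..<p}. if l = k mod p then x l else 0)"
    by (intro sum.cong) (auto simp: cong_ind_def)
  also have "\<dots> = x (k mod p)"
    using assms(1) by simp
  also have "\<dots> = x k"
    by (intro periodicD[OF assms(2)]) (simp add: cong_def)
  finally show ?thesis .
qed

lemma sum_cong_ind_const:
  assumes "p > 0"
  shows "(\<Sum>k\<in>{0..<p}. cong_ind p k a * c) = c"
  using sum_cong_ind[OF assms, of "\<lambda>_. c" a] by (simp add: periodic_def cong_ind_commute)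

text \<open>\<open>s\<close> is 1 or -1, so the affine map permutes Z/p; this treats shifts and
  reflections together.\<close>

lemma sum_periodic_affine:
  assumes p: "p > 0" and x: "periodic p x" and s: "s * s = 1"
  shows "(\<Sum>k\<in>{0..<p}. x (c + s * k)) = (\<Sum>k\<in>{0..<p}. x k)"
proof (rule sum.reindex_bij_witness[where i = "\<lambda>l. s * (l - c) mod p" and j = "\<lambda>k. (c + s * k) mod p"])
  fix k assume k: "k \<in> {0..<p}"
  have "[s * ((c + s * k) mod p - c) = s * ((c + s * k) - c)] (mod p)"
    by (intro cong_mult cong_diff) (auto simp: cong_def)
  also have "s * ((c + s * k) - c) = k" using s by (simp add: mult.assoc[symmetric])
  finally show "s * ((c + s * k) mod p - c) mod p = k" using k by (simp add: cong_def)
  have "[c + s * (s * (k - c) mod p) = c + s * (s * (k - c))] (mod p)"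
    by (intro cong_mult cong_add) (auto simp: cong_def)
  also have "c + s * (s * (k - c)) = k" using s by (simp add: mult.assoc[symmetric])
  finally show "(c + s * (s * (k - c) mod p)) mod p = k" using k by (simp add: cong_def)
  show "x ((c + s * k) mod p) = x (c + s * k)"
    by (intro periodicD[OF x]) (simp add: cong_def)
qed (use p in auto)

section \<open>From trivial kernels to exceptional cliques\<close>

text \<open>\<open>f\<close> is a matrix indexed by the residues \<open>0, \<dots>, p - 1\<close>, of which the rows and columns below \<open>q\<close> are deleted.\<close>
definition trivial_kernel :: "int \<Rightarrow> int \<Rightarrow> (int \<Rightarrow> int \<Rightarrow> int) \<Rightarrow> bool" where
  "trivial_kernel p q f \<longleftrightarrow>
     (\<forall>m x. periodic p x \<longrightarrow> (\<forall>k\<in>{0..<q}. x k = 0) \<longrightarrow>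
        (\<forall>k\<in>{q..<p}. m dvd (\<Sum>l\<in>{0..<p}. f k l * x l)) \<longrightarrow> (\<forall>k. m dvd x k))"

lemma trivial_kernel_diff_commute:
  assumes "trivial_kernel p q (\<lambda>k l. f k l - g k l)"
  shows "trivial_kernel p q (\<lambda>k l. g k l - f k l)"
proof -
  have "(\<Sum>l\<in>{0..<p}. (g k l - f k l) * x l) = - (\<Sum>l\<in>{0..<p}. (f k l - g k l) * x l)" for k x
    by (simp add: sum_negf[symmetric] algebra_simps)
  thus ?thesis using assms by (simp add: trivial_kernel_def)
qed

text \<open>Both sizes are covered: q = 1 gives size p - 1 and q = 0 gives size p.\<close>

definition residue_mat :: "nat \<Rightarrow> nat \<Rightarrow> (int \<Rightarrow> int \<Rightarrow> int) \<Rightarrow> int mat" where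
  "residue_mat p q f = mat (p - q) (p - q) (\<lambda>(i, j). f (int (i + q)) (int (j + q)))"

lemma residue_mat_Units:
  assumes q: "q \<le> p" "0 < p" and ker: "trivial_kernel (int p) (int q) f"
  shows "residue_mat p q f \<in> Units (int_mat_ring (p - q))"
proof (rule Units_int_mat_ringI)
  show "residue_mat p q f \<in> carrier_mat (p - q) (p - q)"
    by (simp add: residue_mat_def)
next
  fix m v assume v: "v \<in> carrier_vec (p - q)"
    and dvd: "\<forall>i<p - q. m dvd (residue_mat p q f *\<^sub>v v) $ i"
  \<comment> \<open>The vector is extended periodically, with the value 0 at the deleted columns, so
    that the sum over all residues equals the matrix product.\<close>
  define x where "x k = (let r = nat (k mod int p) in if r < q then 0 else v $ (r - q))" for k
  have x: "periodic (int p) x"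
    by (auto simp: periodic_def x_def cong_def)
  have nat_mod: "nat (int j mod int p) = j" if "j < p" for j
    using that by (metis mod_less nat_int zmod_int)
  have x_low: "x (int j) = 0" if "j < q" for j
    using that q nat_mod[of j] unfolding x_def by simp
  have x_high: "x (int (j + q)) = v $ j" if "j < p - q" for j
    using that q nat_mod[of "j + q"] unfolding x_def by simp
  have sum_eq: "(\<Sum>l\<in>{0..<int p}. f k l * x l) = (\<Sum>j<p - q. f k (int (j + q)) * v $ j)" for k
  proof -
    have "(\<Sum>l\<in>{0..<int p}. f k l * x l) = (\<Sum>l\<in>{0..<p}. f k (int l) * x (int l))"
      by (rule sum.reindex_bij_witness[of _ int nat]) auto
    also have "\<dots> = (\<Sum>l\<in>{0..<q}. f k (int l) * x (int l)) + (\<Sum>l\<in>{q..<p}. f k (int l) * x (int l))"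
      using q by (intro sum.atLeastLessThan_concat[symmetric]) auto
    also have "(\<Sum>l\<in>{0..<q}. f k (int l) * x (int l)) = 0"
      by (simp add: x_low)
    also have "(\<Sum>l\<in>{q..<p}. f k (int l) * x (int l)) = (\<Sum>j<p - q. f k (int (j + q)) * v $ j)"
      by (rule sum.reindex_bij_witness[of _ "\<lambda>j. j + q" "\<lambda>l. l - q"]) (auto simp: x_high[symmetric])
    finally show ?thesis by simp
  qed
  have mult_eq: "(residue_mat p q f *\<^sub>v v) $ i
      = (\<Sum>j<p - q. f (int (i + q)) (int (j + q)) * v $ j)" if "i < p - q" for i
    using that v by (simp add: residue_mat_def scalar_prod_def atLeast0LessThan)
  have "m dvd (\<Sum>l\<in>{0..<int p}. f k l * x l)" if "k \<in> {int q..<int p}" for k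
  proof -
    have i: "nat k - q < p - q" "int (nat k - q + q) = k" using that by auto
    have "m dvd (residue_mat p q f *\<^sub>v v) $ (nat k - q)" using dvd i by blast
    thus ?thesis unfolding mult_eq[OF i(1)] i(2) sum_eq .
  qed
  moreover have "\<forall>k\<in>{0..<int q}. x k = 0"
    using x_low by (metis atLeastLessThan_iff nat_0_le of_nat_less_iff)
  ultimately have "m dvd x k" for k
    using ker x unfolding trivial_kernel_def by blast
  thus "\<forall>i<p - q. m dvd v $ i" using x_high by metis
qed

lemma (in ring) add_minus_cancel:
  assumes "a \<in> carrier R" "b \<in> carrier R"
  shows "a \<oplus> b \<ominus> b = a"
  using assms by (simp add: minus_eq a_assoc r_neg)

lemma residue_mat_family_clique:
  assumes q: "q < p" and I: "finite I"
    and ker: "\<And>i j. i \<in> I \<Longrightarrow> j \<in> I \<Longrightarrow> i \<noteq> j \<Longrightarrow> trivial_kernel (int p) (int q) (\<lambda>k l. F i k l - F j k l)"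
  shows "exceptional_clique (int_mat_ring (p - q)) ((\<lambda>i. residue_mat p q (F i)) ` I)"
    and "card ((\<lambda>i. residue_mat p q (F i)) ` I) = card I"
proof -
  let ?M = "\<lambda>i. residue_mat p q (F i)" and ?R = "int_mat_ring (p - q)"
  interpret R: ring ?R by (rule ring_mat)
  have carr: "residue_mat p q f \<in> carrier ?R" for f
    by (simp add: residue_mat_def ring_mat_def)
  have minus: "?M i \<ominus>\<^bsub>?R\<^esub> ?M j = residue_mat p q (\<lambda>k l. F i k l - F j k l)" for i j
  proof -
    \<comment> \<open>Ring subtraction uses the abstract additive inverse, so the difference is
      identified by adding the subtrahend back.\<close>
    have "residue_mat p q (\<lambda>k l. F i k l - F j k l) \<oplus>\<^bsub>?R\<^esub> ?M j = ?M i"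
      unfolding ring_mat_simps by (rule eq_matI) (simp_all add: residue_mat_def)
    hence "?M i \<ominus>\<^bsub>?R\<^esub> ?M j = residue_mat p q (\<lambda>k l. F i k l - F j k l) \<oplus>\<^bsub>?R\<^esub> ?M j \<ominus>\<^bsub>?R\<^esub> ?M j"
      by (simp only:)
    also have "\<dots> = residue_mat p q (\<lambda>k l. F i k l - F j k l)"
      by (rule R.add_minus_cancel) (rule carr)+
    finally show ?thesis .
  qed
  have unit: "?M i \<ominus>\<^bsub>?R\<^esub> ?M j \<in> Units ?R" if "i \<in> I" "j \<in> I" "i \<noteq> j" for i j
    unfolding minus using that q ker by (intro residue_mat_Units) auto
  show "exceptional_clique ?R (?M ` I)"
    unfolding exceptional_clique_def using carr unit by (smt (verit) imageE image_subsetI)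
  \<comment> \<open>Since q < p, the ring is nontrivial. A unit difference is therefore nonzero, and
    distinct indices give distinct matrices.\<close>
  have "\<zero>\<^bsub>?R\<^esub> \<notin> Units ?R"
  proof
    assume "\<zero>\<^bsub>?R\<^esub> \<in> Units ?R"
    hence "\<zero>\<^bsub>?R\<^esub> = \<one>\<^bsub>?R\<^esub>"
      by (metis R.Units_l_inv R.Units_inv_closed R.r_null)
    hence "(0\<^sub>m (p - q) (p - q) :: int mat) $$ (0, 0) = 1\<^sub>m (p - q) $$ (0, 0)"
      by (simp add: ring_mat_def)
    thus False using q by simp
  qed
  hence "inj_on ?M I"
    using unit carr by (intro inj_onI) (metis R.r_neg R.minus_eq)
  thus "card (?M ` I) = card I" by (rule card_image)
qed

section \<open>The cycle matrix, the reflections and their action on periodic sequences\<close>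

definition cycle_ind :: "int \<Rightarrow> int \<Rightarrow> int \<Rightarrow> int" where
  "cycle_ind p k l = cong_ind p (k + 1) l + cong_ind p (k - 1) l - cong_ind p k l"

definition reflection_ind :: "int \<Rightarrow> int \<Rightarrow> int \<Rightarrow> int \<Rightarrow> int" where
  "reflection_ind p a k l = cong_ind p (2 * a - k) l"

text \<open>All rows of the cycle and reflection matrices sum to 1, so their plain differences kill
  the constant sequences. The diagonal correction breaks this without deleting a row.\<close>

definition twisted_reflection_ind :: "int \<Rightarrow> int \<Rightarrow> int \<Rightarrow> int \<Rightarrow> int" where
  "twisted_reflection_ind p a k l = reflection_ind p a k l
     - cong_ind p k a * cong_ind p a l + cong_ind p k (a + 2) * cong_ind p (a + 2) l"

lemma sum_cycle_ind:
  assumes "p > 0" "periodic p x"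
  shows "(\<Sum>l\<in>{0..<p}. cycle_ind p k l * x l) = x (k + 1) + x (k - 1) - x k"
  by (simp add: cycle_ind_def ring_distribs sum.distrib sum_subtractf sum_cong_ind[OF assms])

lemma sum_reflection_ind:
  assumes "p > 0" "periodic p x"
  shows "(\<Sum>l\<in>{0..<p}. reflection_ind p a k l * x l) = x (2 * a - k)"
  by (simp add: reflection_ind_def sum_cong_ind[OF assms])

lemma sum_twisted_reflection_ind:
  assumes "p > 0" "periodic p x"
  shows "(\<Sum>l\<in>{0..<p}. twisted_reflection_ind p a k l * x l)
    = x (2 * a - k) - cong_ind p k a * x a + cong_ind p k (a + 2) * x (a + 2)"
  by (simp add: twisted_reflection_ind_def ring_distribs sum.distrib sum_subtractf mult.assoc
      sum_cong_ind[OF assms] sum_reflection_ind[OF assms] flip: sum_distrib_left)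

text \<open>Recovers the equation of the deleted row 0: its left side is minus the sum of all the
  others.\<close>

lemma dvd_all_if_sum_eq_zero:
  fixes g :: "int \<Rightarrow> int"
  assumes p: "p > 0" and g: "periodic p g" and sum: "(\<Sum>k\<in>{0..<p}. g k) = 0"
    and dvd: "\<And>k. k \<in> {1..<p} \<Longrightarrow> m dvd g k"
  shows "m dvd g k"
proof -
  have "{0..<p} = insert 0 {1..<p}" using p by auto
  hence "g 0 = - (\<Sum>k\<in>{1..<p}. g k)" using sum by simp
  moreover have "m dvd (\<Sum>k\<in>{1..<p}. g k)" by (intro dvd_sum dvd)
  ultimately have "m dvd g 0" by simp
  moreover have "k mod p = 0 \<or> k mod p \<in> {1..<p}"
    using pos_mod_sign[OF p, of k] pos_mod_bound[OF p, of k] unfolding atLeastLessThan_iff by linarith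
  ultimately have "m dvd g (k mod p)" using dvd by metis
  moreover have "g k = g (k mod p)" by (intro periodicD[OF g]) (simp add: cong_def)
  ultimately show ?thesis by simp
qed

lemma periodic_affine:
  assumes "periodic p x"
  shows "periodic p (\<lambda>k. x (c + s * k))"
  unfolding periodic_def by (blast intro: periodicD[OF assms] cong_add cong_mult cong_refl)

lemma sum_shifts_reflection:
  assumes p: "p > 0" and x: "periodic p x"
  shows "(\<Sum>k\<in>{0..<p}. x (k + c)) = (\<Sum>k\<in>{0..<p}. x k)"
    and "(\<Sum>k\<in>{0..<p}. x (k - c)) = (\<Sum>k\<in>{0..<p}. x k)"
    and "(\<Sum>k\<in>{0..<p}. x (c - k)) = (\<Sum>k\<in>{0..<p}. x k)"
  using sum_periodic_affine[OF p x, of 1 c] sum_periodic_affine[OF p x, of 1 "- c"]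
    sum_periodic_affine[OF p x, of "-1" c]
  by (simp_all add: add.commute)

lemma periodic_shifts_reflection:
  assumes x: "periodic p x"
  shows "periodic p (\<lambda>k. x (k + c))" "periodic p (\<lambda>k. x (k - c))" "periodic p (\<lambda>k. x (c - k))"
  using periodic_affine[OF x, of c 1] periodic_affine[OF x, of "- c" 1] periodic_affine[OF x, of c "-1"]
  by (simp_all add: add.commute)

lemma periodic_add: "periodic p f \<Longrightarrow> periodic p g \<Longrightarrow> periodic p (\<lambda>k. f k + g k)"
  and periodic_diff: "periodic p f \<Longrightarrow> periodic p g \<Longrightarrow> periodic p (\<lambda>k. f k - g k)"
  unfolding periodic_def by metis+

lemma dvd_all_if_dvd_diffs:
  fixes x :: "int \<Rightarrow> int"
  assumes "\<And>k l. m dvd x k - x l" "m dvd x a"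
  shows "m dvd x k"
  using dvd_add[OF assms(1)[of k a] assms(2)] by simp

section \<open>Kernels of the differences in size p - 1\<close>

text \<open>Shifts and reflections preserve the sum over a period, so the row expressions add up to
  0 and the deleted equation holds too. The recursion makes x constant modulo m, and the deleted
  column fixes the constant as x 0 = 0.\<close>

lemma trivial_kernel_cycle_reflection:
  assumes p: "odd p" "p > 0"
  shows "trivial_kernel p 1 (\<lambda>k l. cycle_ind p k l - reflection_ind p a k l)"
  unfolding trivial_kernel_def
proof (intro allI impI)
  fix m x k
  assume x: "periodic p x" and x0: "\<forall>k\<in>{0..<1}. x k = 0"
    and dvd: "\<forall>k\<in>{1..<p}. m dvd (\<Sum>l\<in>{0..<p}. (cycle_ind p k l - reflection_ind p a k l) * x l)"
  let ?g = "\<lambda>k. x (k + 1) + x (k - 1) - x k - x (2 * a - k)"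
  have "m dvd ?g k" for k
  proof (rule dvd_all_if_sum_eq_zero[where g = ?g, OF p(2)])
    show "periodic p ?g"
      by (intro periodic_add periodic_diff periodic_shifts_reflection[OF x] x)
    show "(\<Sum>k\<in>{0..<p}. ?g k) = 0"
      by (simp add: sum.distrib sum_subtractf sum_shifts_reflection[OF p(2) x])
    show "m dvd ?g k" if "k \<in> {1..<p}" for k
      using dvd[rule_format, OF that]
      by (simp add: left_diff_distrib sum_subtractf sum_cycle_ind[OF p(2) x] sum_reflection_ind[OF p(2) x])
  qed
  from reflected_recursion_const_mod[OF x p this] show "m dvd x k"
    by (rule dvd_all_if_dvd_diffs[of m x 0]) (use x0 in simp)
qed

text \<open>Composing the two reflections is the translation by 2 (a - b), which generates Z/p
  because p is an odd prime. Hence x is constant modulo m, and x 0 = 0.\<close>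

lemma trivial_kernel_reflection_reflection:
  assumes p: "prime p" "odd p" and ab: "\<not> [a = b] (mod p)"
  shows "trivial_kernel p 1 (\<lambda>k l. reflection_ind p a k l - reflection_ind p b k l)"
  unfolding trivial_kernel_def
proof (intro allI impI)
  fix m x k
  assume x: "periodic p x" and x0: "\<forall>k\<in>{0..<1}. x k = 0"
    and dvd: "\<forall>k\<in>{1..<p}. m dvd (\<Sum>l\<in>{0..<p}. (reflection_ind p a k l - reflection_ind p b k l) * x l)"
  have p0: "p > 0" using p(1) by (rule prime_gt_0_int)
  let ?g = "\<lambda>k. x (2 * a - k) - x (2 * b - k)"
  have g: "m dvd ?g k" for k
  proof (rule dvd_all_if_sum_eq_zero[where g = ?g, OF p0])
    show "periodic p ?g"
      by (intro periodic_diff periodic_shifts_reflection[OF x] x)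
    show "(\<Sum>k\<in>{0..<p}. ?g k) = 0"
      by (simp add: sum_subtractf sum_shifts_reflection[OF p0 x])
    show "m dvd ?g k" if "k \<in> {1..<p}" for k
      using dvd[rule_format, OF that]
      by (simp add: left_diff_distrib sum_subtractf sum_reflection_ind[OF p0 x])
  qed
  have "\<not> p dvd 2 * (a - b)"
    using p ab prime_dvd_mult_iff[OF p(1), of 2 "a - b"] primes_dvd_imp_eq[OF p(1), of 2]
    by (auto simp: cong_iff_dvd_diff)
  hence "coprime (2 * (a - b)) p"
    using p(1) by (simp add: prime_imp_coprime coprime_commute)
  moreover have "m dvd x (k + 2 * (a - b)) - x k" for k
    using g[of "2 * b - k"] by (simp add: algebra_simps)
  ultimately have "m dvd x k - x l" for k l
    using periodic_const_mod[OF x _ p0] by blast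
  thus "m dvd x k"
    by (rule dvd_all_if_dvd_diffs[of m x 0]) (use x0 in simp)
qed

section \<open>Kernels of the differences in size p\<close>

lemma cong_ind_small: "\<bar>k - l\<bar> < p \<Longrightarrow> cong_ind p k l = (if k = l then 1 else 0)"
  using dvd_imp_le_int[of "k - l" p] by (auto simp: cong_ind_def cong_iff_dvd_diff)

text \<open>The sum of all rows equates x a and x (a + 2) modulo m, and rows a and a + 1 add up to x
  (a + 2). Both correction terms therefore vanish, which leaves the untwisted recursion.\<close>

lemma trivial_kernel_cycle_twisted_reflection:
  assumes p: "odd p" "p > 2"
  shows "trivial_kernel p 0 (\<lambda>k l. cycle_ind p k l - twisted_reflection_ind p a k l)"
  unfolding trivial_kernel_def
proof (intro allI impI)
  fix m x k
  assume x: "periodic p x"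
    and dvd: "\<forall>k\<in>{0..<p}. m dvd (\<Sum>l\<in>{0..<p}. (cycle_ind p k l - twisted_reflection_ind p a k l) * x l)"
  have p0: "p > 0" using p by simp
  let ?g = "\<lambda>k. x (k + 1) + x (k - 1) - x k - x (2 * a - k)"
  let ?h = "\<lambda>k. ?g k + cong_ind p k a * x a - cong_ind p k (a + 2) * x (a + 2)"
  have hg: "(\<Sum>l\<in>{0..<p}. (cycle_ind p k l - twisted_reflection_ind p a k l) * x l) = ?h k" for k
    by (simp add: left_diff_distrib sum_subtractf sum_cycle_ind[OF p0 x]
        sum_twisted_reflection_ind[OF p0 x])
  have "periodic p (\<lambda>k. cong_ind p k b * c)" for b c
    by (simp add: periodic_def cong_ind_def cong_def)
  hence "periodic p ?h"
    by (intro periodic_add periodic_diff periodic_shifts_reflection[OF x] x)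
  hence "?h k = ?h (k mod p)" for k
    by (rule periodicD) (simp add: cong_def)
  hence h: "m dvd ?h k" for k
    using dvd[unfolded hg, rule_format, of "k mod p"] p0 by simp
  have "(\<Sum>k\<in>{0..<p}. ?h k) = x a - x (a + 2)"
    by (simp add: sum.distrib sum_subtractf sum_shifts_reflection[OF p0 x] sum_cong_ind_const[OF p0])
  hence diff: "m dvd x a - x (a + 2)"
    using dvd_sum[of "{0..<p}" m ?h] h by simp
  have "m dvd ?h a + ?h (a + 1)" by (intro dvd_add h)
  also have "?h a + ?h (a + 1) = x (a + 2)"
    using p by (simp add: cong_ind_small algebra_simps)
  finally have xa2: "m dvd x (a + 2)" .
  have xa: "m dvd x a" using dvd_add[OF diff xa2] by simp
  have "m dvd ?g k" for k
  proof -
    have "m dvd ?h k - cong_ind p k a * x a + cong_ind p k (a + 2) * x (a + 2)"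
      by (rule dvd_add[OF dvd_diff[OF h]]) (intro dvd_mult xa xa2)+
    also have "?h k - cong_ind p k a * x a + cong_ind p k (a + 2) * x (a + 2) = ?g k"
      by (simp add: algebra_simps)
    finally show ?thesis .
  qed
  from reflected_recursion_const_mod[OF x p(1) p0 this] xa show "m dvd x k"
    by (rule dvd_all_if_dvd_diffs)
qed

text \<open>Substituting \<open>W j = x (a + (b - a) j)\<close> puts both diagonal corrections at \<open>j = 0, -1, -\<tau>, -\<tau> - 1\<close>.
  Exchanging \<open>a\<close> and \<open>b\<close> replaces \<open>\<tau>\<close> by \<open>p - \<tau>\<close>, so an odd \<open>\<tau>\<close> suffices.\<close>
lemma trivial_kernel_twisted_reflections_aux:
  assumes p: "prime p" "odd p" and ab: "\<not> [a = b] (mod p)"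
    and \<tau>: "odd \<tau>" "0 < \<tau>" "\<tau> < p" "[\<tau> * (b - a) = 2] (mod p)"
  shows "trivial_kernel p 0 (\<lambda>k l. twisted_reflection_ind p a k l - twisted_reflection_ind p b k l)"
  unfolding trivial_kernel_def
proof (intro allI impI)
  fix m x k
  assume x: "periodic p x"
    and dvd: "\<forall>k\<in>{0..<p}. m dvd
      (\<Sum>l\<in>{0..<p}. (twisted_reflection_ind p a k l - twisted_reflection_ind p b k l) * x l)"
  have p0: "p > 0" using p(1) by (rule prime_gt_0_int)
  define d where "d = b - a"
  define W where "W j = x (a + d * j)" for j
  let ?t = "\<lambda>a k. x (2 * a - k) - cong_ind p k a * x a + cong_ind p k (a + 2) * x (a + 2)"
  let ?h = "\<lambda>k. ?t a k - ?t b k"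
  have hg: "(\<Sum>l\<in>{0..<p}. (twisted_reflection_ind p a k l - twisted_reflection_ind p b k l) * x l) = ?h k"
    for k
    by (simp only: left_diff_distrib sum_subtractf sum_twisted_reflection_ind[OF p0 x])
  have "periodic p (\<lambda>k. cong_ind p k b * c)" for b c
    by (simp add: periodic_def cong_ind_def cong_def)
  hence "periodic p ?h"
    by (intro periodic_add periodic_diff periodic_shifts_reflection[OF x] x)
  hence "?h k = ?h (k mod p)" for k
    by (rule periodicD) (simp add: cong_def)
  hence h: "m dvd ?h k" for k
    using dvd[unfolded hg, rule_format, of "k mod p"] p0 by simp
  have pd: "\<not> p dvd d" using ab by (simp add: d_def cong_iff_dvd_diff dvd_diff_commute)
  have W: "periodic p W" unfolding W_def by (rule periodic_affine[OF x])
  \<comment> \<open>As \<tau> d = 2 in Z/p, the corrected indices a, b, a + 2, b + 2 are the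
    positions 0, 1, \<tau>, \<tau> + 1 of \<open>W\<close>.\<close>
  have a2: "[a + d * \<tau> = a + 2] (mod p)" and b2: "[a + d * (\<tau> + 1) = b + 2] (mod p)"
    using \<tau>(4) by (auto simp: d_def cong_iff_dvd_diff algebra_simps)
  hence val: "x a = W 0" "x b = W 1" "x (a + 2) = W \<tau>" "x (b + 2) = W (\<tau> + 1)"
    using periodicD[OF x] by (auto simp: W_def d_def)
  \<comment> \<open>The row k = a - d j is chosen since 2a - k and 2b - k are then the positions j
    and j + 2 of \<open>W\<close>. A correction at position t occurs in this row exactly when j = -t
    in Z/p; t = 0 is separate because j < p.\<close>
  have ind: "cong_ind p (a - d * j) c = (if j = (if t = 0 then 0 else p - t) then 1 else 0)"
    if "0 \<le> j" "j < p" "0 \<le> t" "t < p" "[a + d * t = c] (mod p)" for j t c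
  proof -
    have "[a - d * j = c] (mod p) \<longleftrightarrow> [a - d * j = a + d * t] (mod p)"
      using that(5) by (metis cong_sym cong_trans)
    also have "\<dots> \<longleftrightarrow> p dvd d * (j + t)"
      unfolding cong_iff_dvd_diff by (subst dvd_minus_iff[symmetric]) (simp add: algebra_simps)
    also have "\<dots> \<longleftrightarrow> p dvd j + t"
      using pd by (simp add: prime_dvd_mult_iff[OF p(1)])
    also have "\<dots> \<longleftrightarrow> j = (if t = 0 then 0 else p - t)"
    proof
      assume "p dvd j + t"
      then obtain c where c: "j + t = p * c" by blast
      have "p * c < p * 2" "0 \<le> p * c" using c that by linarith+
      hence "c = 0 \<or> c = 1" using p0 by (auto simp: zero_le_mult_iff)
      thus "j = (if t = 0 then 0 else p - t)" using c that by auto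
    qed auto
    finally show ?thesis by (simp add: cong_ind_def)
  qed
  \<comment> \<open>Both numbers are odd, so \<tau> is not p - 1. This keeps \<tau> + 1 a reduced
    position.\<close>
  have odd_lt: "\<tau> + 1 < p" using \<tau> p(2) by presburger
  have "m dvd W j" for j
  proof (rule twisted_recursion_zero_mod[OF W])
    show p_eq: "p = 2 * int (nat (p div 2)) + 1" using p(2) p0 by simp
    show \<tau>_eq: "\<tau> = 2 * int (nat (\<tau> div 2)) + 1" using \<tau> by simp
    show "nat (\<tau> div 2) < nat (p div 2)" using odd_lt p_eq \<tau>_eq by linarith
    fix j assume j: "0 \<le> j" "j < p"
    have x_eq: "x (2 * a - (a - d * j)) = W j" "x (2 * b - (a - d * j)) = W (j + 2)"
      by (simp_all add: W_def d_def algebra_simps)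
    have "m dvd - ?h (a - d * j)" using h by (simp only: dvd_minus_iff)
    also have "- ?h (a - d * j) = W (j + 2) - W j
        + cong_ind p (a - d * j) a * W 0 - cong_ind p (a - d * j) b * W 1
        - cong_ind p (a - d * j) (a + 2) * W \<tau> + cong_ind p (a - d * j) (b + 2) * W (\<tau> + 1)"
      unfolding x_eq val by (simp only: algebra_simps)
    also have "cong_ind p (a - d * j) a = (if j = 0 then 1 else 0)"
      using ind[OF j, of 0 a] p0 by simp
    also have "cong_ind p (a - d * j) b = (if j = p - 1 then 1 else 0)"
      using ind[OF j, of 1 b] odd_lt \<tau>(2) by (simp add: d_def)
    also have "cong_ind p (a - d * j) (a + 2) = (if j = p - \<tau> then 1 else 0)"
      using ind[OF j, of \<tau> "a + 2"] a2 \<tau>(2,3) by simp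
    also have "cong_ind p (a - d * j) (b + 2) = (if j = p - \<tau> - 1 then 1 else 0)"
      using ind[OF j, of "\<tau> + 1" "b + 2"] b2 odd_lt \<tau>(2) by (simp add: diff_diff_eq)
    finally show "m dvd W (j + 2) - W j + (if j = 0 then W 0 else 0) - (if j = p - 1 then W 1 else 0)
        - (if j = p - \<tau> then W \<tau> else 0) + (if j = p - \<tau> - 1 then W (\<tau> + 1) else 0)"
      by (simp only: if_distrib[of "\<lambda>c. c * _"] mult_1_left mult_zero_left)
  qed
  \<comment> \<open>\<open>d\<close> is invertible modulo p, so \<open>W\<close> takes every value
    of x.\<close>
  moreover obtain s where s: "[a + int s * d = k] (mod p)"
    using cong_nat_multiple[of d p a k] pd p0 p(1) by (metis coprime_commute prime_imp_coprime)
  hence "W (int s) = x k"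
    unfolding W_def by (intro periodicD[OF x]) (simp add: mult.commute)
  ultimately show "m dvd x k" by metis
qed

text \<open>\<tau> is the residue of 2 / (b - a). If it is even, p - \<tau> is odd and serves for
  the exchanged pair.\<close>

lemma trivial_kernel_twisted_reflections:
  assumes p: "prime p" "odd p" and ab: "\<not> [a = b] (mod p)"
  shows "trivial_kernel p 0 (\<lambda>k l. twisted_reflection_ind p a k l - twisted_reflection_ind p b k l)"
proof -
  have p0: "p > 0" using p(1) by (rule prime_gt_0_int)
  have "\<not> p dvd b - a" using ab by (simp add: cong_iff_dvd_diff dvd_diff_commute)
  hence "coprime (b - a) p" using p(1) by (simp add: prime_imp_coprime coprime_commute)
  then obtain s where s: "[0 + int s * (b - a) = 2] (mod p)"
    using cong_nat_multiple p0 by blast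
  define \<tau> where "\<tau> = int s mod p"
  have "[\<tau> * (b - a) = int s * (b - a)] (mod p)"
    by (intro cong_mult) (auto simp: \<tau>_def cong_def)
  also have "[int s * (b - a) = 2] (mod p)" using s by simp
  finally have \<tau>: "[\<tau> * (b - a) = 2] (mod p)" .
  have "\<not> p dvd 2" using p primes_dvd_imp_eq[OF p(1), of 2] by auto
  with \<tau> have "\<tau> \<noteq> 0" by (auto simp: cong_iff_dvd_diff)
  hence range: "0 < \<tau>" "\<tau> < p"
    using pos_mod_sign[OF p0, of "int s"] pos_mod_bound[OF p0, of "int s"] unfolding \<tau>_def by linarith+
  show ?thesis
  proof (cases "odd \<tau>")
    case True
    thus ?thesis using trivial_kernel_twisted_reflections_aux[OF p ab True range \<tau>] by simp
  next
    case False
    have "[(p - \<tau>) * (a - b) = 2] (mod p)"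
    proof -
      have "p dvd p * (a - b) + (\<tau> * (b - a) - 2)"
        using \<tau> unfolding cong_iff_dvd_diff by (intro dvd_add) auto
      thus ?thesis by (simp add: cong_iff_dvd_diff algebra_simps)
    qed
    moreover have "\<not> [b = a] (mod p)" using ab by (simp add: cong_sym_eq)
    ultimately have "trivial_kernel p 0
        (\<lambda>k l. twisted_reflection_ind p b k l - twisted_reflection_ind p a k l)"
      using False range p by (intro trivial_kernel_twisted_reflections_aux[of p b a "p - \<tau>"]) auto
    thus ?thesis by (rule trivial_kernel_diff_commute)
  qed
qed

section \<open>Symmetry and size of the entries\<close>

lemma residue_mat_symmetric:
  assumes "\<And>k l. f k l = f l k"
  shows "transpose_mat (residue_mat p q f) = residue_mat p q f"
  by (rule eq_matI) (auto simp: residue_mat_def assms)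

lemma residue_mat_elements:
  assumes "\<And>k l. f k l \<in> S"
  shows "elements_mat (residue_mat p q f) \<subseteq> S"
  using assms by (auto simp: residue_mat_def elements_mat_def)

lemma cycle_ind_symmetric: "cycle_ind p k l = cycle_ind p l k"
proof -
  have "cong_ind p (k + 1) l = cong_ind p (l - 1) k" "cong_ind p (k - 1) l = cong_ind p (l + 1) k"
    unfolding cong_ind_def cong_iff_dvd_diff
    by (subst dvd_diff_commute, simp add: algebra_simps)+
  thus ?thesis by (simp add: cycle_ind_def cong_ind_commute)
qed

lemma reflection_ind_symmetric: "reflection_ind p a k l = reflection_ind p a l k"
  by (simp add: reflection_ind_def cong_ind_def cong_iff_dvd_diff algebra_simps)

lemma twisted_reflection_ind_symmetric:
  "twisted_reflection_ind p a k l = twisted_reflection_ind p a l k"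
  by (simp add: twisted_reflection_ind_def reflection_ind_symmetric[of p a k l] cong_ind_commute mult.commute)

text \<open>For p > 2 the residues k + 1 and k - 1 differ, so the two ones never add up.\<close>

lemma cycle_ind_values:
  assumes "p > 2"
  shows "cycle_ind p k l \<in> {-1, 0, 1}"
proof -
  have "\<not> ([k + 1 = l] (mod p) \<and> [k - 1 = l] (mod p))"
  proof
    assume "[k + 1 = l] (mod p) \<and> [k - 1 = l] (mod p)"
    hence "[k + 1 = k - 1] (mod p)" by (meson cong_sym cong_trans)
    hence "p dvd 2" by (simp add: cong_iff_dvd_diff)
    thus False using assms by (auto dest: zdvd_imp_le)
  qed
  thus ?thesis by (auto simp: cycle_ind_def cong_ind_def)
qed

text \<open>The value 2 would require the reflection to fix a + 2, that is, p to divide 4.\<close>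

lemma twisted_reflection_ind_values:
  assumes p: "odd p" "p > 2"
  shows "twisted_reflection_ind p a k l \<in> {-1, 0, 1}"
proof -
  have nc: "\<not> ([2 * a - k = l] (mod p) \<and> [k = a + 2] (mod p) \<and> [a + 2 = l] (mod p))"
  proof
    assume "[2 * a - k = l] (mod p) \<and> [k = a + 2] (mod p) \<and> [a + 2 = l] (mod p)"
    hence "p dvd (2 * a - k - l) + (k - (a + 2)) - (a + 2 - l)"
      unfolding cong_iff_dvd_diff using dvd_diff[OF dvd_add] by blast
    hence "p dvd - (2 * 2)" by (simp add: algebra_simps)
    hence "p dvd 2 * 2" by (simp only: dvd_minus_iff)
    moreover have "coprime p 2" using p by (simp add: coprime_commute)
    ultimately have "p dvd 2" using coprime_dvd_mult_left_iff by blast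
    thus False using p by (auto dest: zdvd_imp_le)
  qed
  have "(if A then 1 else 0) - (if B then 1 else 0) * (if C then 1 else 0)
      + (if D then 1 else 0) * (if E then 1 else 0) \<in> {-1, 0, 1 :: int}"
    if "\<not> (A \<and> D \<and> E)" for A B C D E
    using that by simp
  from this[OF nc] show ?thesis
    unfolding twisted_reflection_ind_def reflection_ind_def cong_ind_def .
qed

section \<open>Assembly of the cliques in both sizes\<close>

lemma cycle_family_clique:
  fixes p q :: nat
  assumes p: "prime p" "odd p" and q: "q < p"
    and sym: "\<And>a k l. P a k l = P a l k"
    and val: "\<And>a k l. P a k l \<in> {-1, 0, 1}"
    and ker: "\<And>a. trivial_kernel (int p) (int q) (\<lambda>k l. cycle_ind (int p) k l - P a k l)"
      "\<And>a b. \<not> [a = b] (mod int p) \<Longrightarrow> trivial_kernel (int p) (int q) (\<lambda>k l. P a k l - P b k l)"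
  shows "\<exists>C. exceptional_clique (int_mat_ring (p - q)) C \<and> card C = p + 1 \<and>
           (\<forall>A\<in>C. transpose_mat A = A \<and> elements_mat A \<subseteq> {-2, -1, 0, 1})"
proof -
  have p2: "int p > 2" using p prime_ge_2_nat[of p] by (cases "p = 2") auto
  \<comment> \<open>Index -1 stands for the cycle matrix and 0, ..., p - 1 for the family
    \<open>P\<close>, which makes p + 1 matrices.\<close>
  define F where "F i = (if i < 0 then cycle_ind (int p) else P i)" for i
  define I where "I = {-1..<int p}"
  have F_ker: "trivial_kernel (int p) (int q) (\<lambda>k l. F i k l - F j k l)"
    if "i \<in> I" "j \<in> I" "i \<noteq> j" for i j
  proof -
    have "\<not> [i = j] (mod int p)" if "0 \<le> i" "0 \<le> j"
      using that \<open>i \<in> I\<close> \<open>j \<in> I\<close> \<open>i \<noteq> j\<close> by (simp add: I_def cong_def)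
    thus ?thesis
      using that ker trivial_kernel_diff_commute[OF ker(1)] by (auto simp: F_def I_def)
  qed
  have F: "F i k l = F i l k" "F i k l \<in> {-2, -1, 0, 1}" for i k l
    using sym val[of i k l] cycle_ind_symmetric cycle_ind_values[OF p2, of k l] by (auto simp: F_def)
  let ?C = "(\<lambda>i. residue_mat p q (F i)) ` I"
  have "exceptional_clique (int_mat_ring (p - q)) ?C" "card ?C = card I"
    by (rule residue_mat_family_clique[OF q _ F_ker]; simp add: I_def)+
  moreover have "card I = p + 1" by (simp add: I_def)
  ultimately show ?thesis
    using residue_mat_symmetric[OF F(1)] residue_mat_elements[OF F(2)]
    by (intro exI[of _ ?C]) auto
qed

theorem theorem8p7:
  fixes p :: nat
  assumes "prime p" and "odd p"
  shows "\<forall>n\<in>{p - 1, p}. \<exists>C. exceptional_clique (int_mat_ring n) C \<and> card C = p + 1 \<and>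
           (\<forall>A\<in>C. transpose_mat A = A \<and> elements_mat A \<subseteq> {-2, -1, 0, 1})"
proof -
  have p: "prime (int p)" "odd (int p)" using assms by auto
  have p2: "int p > 2" using assms prime_ge_2_nat[of p] by (cases "p = 2") auto
  have "\<exists>C. exceptional_clique (int_mat_ring (p - 1)) C \<and> card C = p + 1 \<and>
           (\<forall>A\<in>C. transpose_mat A = A \<and> elements_mat A \<subseteq> {-2, -1, 0, 1})"
  proof (rule cycle_family_clique[where P = "reflection_ind (int p)" and q = 1, OF assms])
    show "reflection_ind (int p) a k l = reflection_ind (int p) a l k" for a k l
      by (rule reflection_ind_symmetric)
    show "reflection_ind (int p) a k l \<in> {-1, 0, 1}" for a k l
      by (simp add: reflection_ind_def cong_ind_def)
    show "1 < p" using p2 by simp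
    show "trivial_kernel (int p) (int 1) (\<lambda>k l. cycle_ind (int p) k l - reflection_ind (int p) a k l)" for a
      using trivial_kernel_cycle_reflection[OF p(2)] p2 by simp
    show "trivial_kernel (int p) (int 1) (\<lambda>k l. reflection_ind (int p) a k l - reflection_ind (int p) b k l)"
      if "\<not> [a = b] (mod int p)" for a b
      using trivial_kernel_reflection_reflection[OF p that] by simp
  qed
  moreover have "\<exists>C. exceptional_clique (int_mat_ring (p - 0)) C \<and> card C = p + 1 \<and>
           (\<forall>A\<in>C. transpose_mat A = A \<and> elements_mat A \<subseteq> {-2, -1, 0, 1})"
  proof (rule cycle_family_clique[where P = "twisted_reflection_ind (int p)" and q = 0, OF assms])
    show "twisted_reflection_ind (int p) a k l = twisted_reflection_ind (int p) a l k" for a k l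
      by (rule twisted_reflection_ind_symmetric)
    show "twisted_reflection_ind (int p) a k l \<in> {-1, 0, 1}" for a k l
      by (rule twisted_reflection_ind_values[OF p(2) p2])
    show "0 < p" using p2 by simp
    show "trivial_kernel (int p) (int 0) (\<lambda>k l. cycle_ind (int p) k l - twisted_reflection_ind (int p) a k l)" for a
      using trivial_kernel_cycle_twisted_reflection[OF p(2) p2] by simp
    show "trivial_kernel (int p) (int 0)
        (\<lambda>k l. twisted_reflection_ind (int p) a k l - twisted_reflection_ind (int p) b k l)"
      if "\<not> [a = b] (mod int p)" for a b
      using trivial_kernel_twisted_reflections[OF p that] by simp
  qed
  ultimately show ?thesis
    unfolding diff_zero by blast
qed

end
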